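(* Assume that $<_{\mathrm{red}}$ is a total order on $G$ and that $d$ is an elimination map with respect to $(G,<_{\mathrm{red}})$. Then the map $T\mapsto\ker(T)$ is a bijection between $\mathbf{RO}(G,<_{\mathrm{red}},d)$ and the set of closed subspaces of $\widehat{\mathbb{K}G}$. In particular, $\mathbf{RO}(G,<_{\mathrm{red}},d)$ admits lattice operations $(\preceq,\wedge,\vee)$, defined by \begin{itemize} \item $T_1\preceq T_2$ if $\ker(T_2)\subseteq\ker(T_1)$; \item $T_1\wedge T_2:=\ker^{-1}\left(\overline{\ker(T_1)+\ker(T_2)}\right)$; \item $T_1\vee T_2:=\ker^{-1}\left(\ker(T_1)\cap\ker(T_2)\right)$. \end{itemize}
   Context: Let $(G,<_{\mathrm{red}})$ be an ordered set, $d:G\to\mathbb{R}_{>0}$ a map, and $\mathbb{K}$ a commutative field with the discrete topology. $\mathbb{K}G$ is the vector space with basis $G$; $\pi_g:\mathbb{K}G\to\mathbb{K}$ maps $v$ to the coefficient of $g$ in $v$. Equip $\mathbb{K}G$ with the metric $\delta(u,v)=\max\{d(g)\mid\pi_g(u-v)\neq0\}$ (and $\delta(u,u)=0$), and let $(\widehat{\mathbb{K}G},\delta)$ be its completion, a topological vector space to which each $\pi_g$ extends continuously. $\overline{V}$ denotes topological closure in $\widehat{\mathbb{K}G}$. The support of $v\in\widehat{\mathbb{K}G}$ is $\mathrm{supp}(v)=\{g\in G\mid\pi_g(v)\neq0\}$. $\mathbf{RO}(G,<_{\mathrm{red}},d)$ is the set of reduction operators, i.e. continuous linear projectors $T$ of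 $\widehat{\mathbb{K}G}$ such that for every $g\in G$, $T(g)\neq g$ implies $g'<_{\mathrm{red}}g$ for every $g'\in\mathrm{supp}(T(g))$. For every integer $n\geq1$ let $G^{(n)}=\{g\in G\mid 1/n\leq d(g)<1/(n-1)\}$ (with $1/0=+\infty$). The map $d$ is an elimination map with respect to $(G,<_{\mathrm{red}})$ if it is non-decreasing ($g<_{\mathrm{red}}g'$ implies $d(g)\leq d(g')$) and each $G^{(n)}$, with the order induced by $<_{\mathrm{red}}$, is well-ordered. $\ker^{-1}$ denotes the inverse of the bijection $T\mapsto\ker(T)$. *)

theory Defs
  imports "HOL-Algebra.Lattice" "HOL-Analysis.Analysis" "HOL-Library.Function_Algebras"
begin

text \<open>
  The ordered set \<open>(G, <\<^sub>r\<^sub>e\<^sub>d)\<close> is a carrier set \<open>G\<close> with a (reflexive) order relation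
  \<open>r \<subseteq> G \<times> G\<close> in the sense of \<^theory>\<open>HOL.Order_Relation\<close>; \<open>g' <\<^sub>r\<^sub>e\<^sub>d g\<close> is \<open>(g', g) \<in> r - Id\<close>.
  Vectors are functions \<open>'g \<Rightarrow> 'k\<close> vanishing outside \<open>G\<close>, so that \<open>v g\<close> is the coefficient
  \<open>\<pi>\<^sub>g(v)\<close>; only the values of \<open>d\<close> on \<open>G\<close> matter.
\<close>

definition smul :: "'k::field \<Rightarrow> ('g \<Rightarrow> 'k) \<Rightarrow> 'g \<Rightarrow> 'k" where
  "smul c v = (\<lambda>g. c * v g)"

lemma smul_apply [simp]: "smul c v g = c * v g"
  by (simp add: smul_def)

interpretation vec: vector_space "smul :: 'k::field \<Rightarrow> ('g \<Rightarrow> 'k) \<Rightarrow> 'g \<Rightarrow> 'k"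
  by standard (auto simp: fun_eq_iff algebra_simps)

definition supp :: "('g \<Rightarrow> 'k::zero) \<Rightarrow> 'g set" where
  "supp v = {g. v g \<noteq> 0}"

definition basis_vec :: "'g \<Rightarrow> 'g \<Rightarrow> 'k::zero_neq_one" where
  "basis_vec g = (\<lambda>h. if h = g then 1 else 0)"

definition KG :: "'g set \<Rightarrow> ('g \<Rightarrow> 'k::zero) set" where
  "KG G = {v. supp v \<subseteq> G \<and> finite (supp v)}"

text \<open>
  The completion of \<open>KG G\<close>, realised as the space of formal series having, for each \<open>\<epsilon> > 0\<close>,
  only finitely many terms \<open>g\<close> with \<open>d g \<ge> \<epsilon>\<close>.  That this is the metric completion is proved
  below (\<open>Metric_space_KG_hat\<close>, \<open>delta_KG\<close>, \<open>mcomplete_KG_hat\<close>, \<open>KG_dense\<close>), together with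
  the continuity of the vector space operations and of the coefficient maps.
\<close>

definition KG_hat :: "'g set \<Rightarrow> ('g \<Rightarrow> real) \<Rightarrow> ('g \<Rightarrow> 'k::zero) set" where
  "KG_hat G d = {v. supp v \<subseteq> G \<and> (\<forall>\<epsilon>>0. finite {g \<in> supp v. \<epsilon> \<le> d g})}"

text \<open>
  The supremum is attained (\<open>delta_attained\<close>).  The value \<open>0\<close> outside \<open>KG_hat G d\<close> is a dummy:
  the locale \<^locale>\<open>Metric_space\<close> asks for non-negativity on the whole type.
\<close>

definition delta :: "'g set \<Rightarrow> ('g \<Rightarrow> real) \<Rightarrow> ('g \<Rightarrow> 'k::group_add) \<Rightarrow> ('g \<Rightarrow> 'k) \<Rightarrow> real" where
  "delta G d u v =
     (if u \<in> KG_hat G d \<and> v \<in> KG_hat G d \<and> u \<noteq> v then Sup (d ` supp (u - v)) else 0)"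

definition hat_topology :: "'g set \<Rightarrow> ('g \<Rightarrow> real) \<Rightarrow> ('g \<Rightarrow> 'k::group_add) topology" where
  "hat_topology G d = Metric_space.mtopology (KG_hat G d) (delta G d)"

definition closed_subspaces :: "'g set \<Rightarrow> ('g \<Rightarrow> real) \<Rightarrow> ('g \<Rightarrow> 'k::field) set set" where
  "closed_subspaces G d =
     {V. V \<subseteq> KG_hat G d \<and> vec.subspace V \<and> closedin (hat_topology G d) V}"

text \<open>
  Operators are extensional functions (\<open>\<rightarrow>\<^sub>E\<close>), so that two operators are equal as soon as they
  agree on \<open>KG_hat G d\<close>.
\<close>

definition continuous_linear_projector ::
    "'g set \<Rightarrow> ('g \<Rightarrow> real) \<Rightarrow> (('g \<Rightarrow> 'k::field) \<Rightarrow> ('g \<Rightarrow> 'k)) \<Rightarrow> bool" where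
  "continuous_linear_projector G d T \<longleftrightarrow>
     T \<in> KG_hat G d \<rightarrow>\<^sub>E KG_hat G d \<and>
     (\<forall>u \<in> KG_hat G d. \<forall>v \<in> KG_hat G d. T (u + v) = T u + T v) \<and>
     (\<forall>c. \<forall>v \<in> KG_hat G d. T (smul c v) = smul c (T v)) \<and>
     continuous_map (hat_topology G d) (hat_topology G d) T \<and>
     (\<forall>v \<in> KG_hat G d. T (T v) = T v)"

definition RO ::
    "'g set \<Rightarrow> 'g rel \<Rightarrow> ('g \<Rightarrow> real) \<Rightarrow> (('g \<Rightarrow> 'k::field) \<Rightarrow> ('g \<Rightarrow> 'k)) set" where
  "RO G r d =
     {T. continuous_linear_projector G d T \<and>
         (\<forall>g \<in> G. T (basis_vec g) \<noteq> basis_vec g \<longrightarrow>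
            (\<forall>g' \<in> supp (T (basis_vec g)). (g', g) \<in> r - Id))}"

definition ker ::
    "'g set \<Rightarrow> ('g \<Rightarrow> real) \<Rightarrow> (('g \<Rightarrow> 'k::field) \<Rightarrow> ('g \<Rightarrow> 'k)) \<Rightarrow> ('g \<Rightarrow> 'k) set" where
  "ker G d T = {v \<in> KG_hat G d. T v = 0}"

definition level :: "'g set \<Rightarrow> ('g \<Rightarrow> real) \<Rightarrow> nat \<Rightarrow> 'g set" where
  "level G d n = {g \<in> G. 1 / real n \<le> d g \<and> (n = 1 \<or> d g < 1 / (real n - 1))}"

definition elimination_map :: "'g set \<Rightarrow> 'g rel \<Rightarrow> ('g \<Rightarrow> real) \<Rightarrow> bool" where
  "elimination_map G r d \<longleftrightarrow>
     (\<forall>g \<in> G. \<forall>g' \<in> G. (g, g') \<in> r - Id \<longrightarrow> d g \<le> d g') \<and>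
     (\<forall>n\<ge>1. well_order_on (level G d n) (Restr r (level G d n)))"

definition ker_inv ::
    "'g set \<Rightarrow> 'g rel \<Rightarrow> ('g \<Rightarrow> real) \<Rightarrow> ('g \<Rightarrow> 'k::field) set \<Rightarrow> (('g \<Rightarrow> 'k) \<Rightarrow> ('g \<Rightarrow> 'k))" where
  "ker_inv G r d = inv_into (RO G r d) (ker G d)"

definition RO_order ::
    "'g set \<Rightarrow> 'g rel \<Rightarrow> ('g \<Rightarrow> real) \<Rightarrow> (('g \<Rightarrow> 'k::field) \<Rightarrow> ('g \<Rightarrow> 'k)) gorder" where
  "RO_order G r d =
     \<lparr>carrier = RO G r d, eq = (=), le = (\<lambda>T1 T2. ker G d T2 \<subseteq> ker G d T1)\<rparr>"

definition closure_sum ::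
    "'g set \<Rightarrow> ('g \<Rightarrow> real) \<Rightarrow> ('g \<Rightarrow> 'k::field) set \<Rightarrow> ('g \<Rightarrow> 'k) set \<Rightarrow> ('g \<Rightarrow> 'k) set" where
  "closure_sum G d V W = Abstract_Topology.closure_of (hat_topology G d) {v + w | v w. v \<in> V \<and> w \<in> W}"


section \<open>\<open>KG_hat G d\<close> is the completion of \<open>KG G\<close>\<close>

lemma KG_subset_KG_hat: "KG G \<subseteq> KG_hat G d"
  by (auto simp: KG_def KG_hat_def)

lemma KG_hatD: "v \<in> KG_hat G d \<Longrightarrow> v g \<noteq> 0 \<Longrightarrow> g \<in> G"
  by (auto simp: KG_hat_def supp_def)

lemma KG_hat_diff:
  fixes u v :: "'g \<Rightarrow> 'k::field"
  assumes "u \<in> KG_hat G d" "v \<in> KG_hat G d"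
  shows "u - v \<in> KG_hat G d"
proof -
  have "finite {g \<in> supp (u - v). \<epsilon> \<le> d g}" if "\<epsilon> > 0" for \<epsilon>
  proof (rule finite_subset)
    show "{g \<in> supp (u - v). \<epsilon> \<le> d g} \<subseteq> {g \<in> supp u. \<epsilon> \<le> d g} \<union> {g \<in> supp v. \<epsilon> \<le> d g}"
      by (auto simp: supp_def)
    show "finite ({g \<in> supp u. \<epsilon> \<le> d g} \<union> {g \<in> supp v. \<epsilon> \<le> d g})"
      using assms that by (auto simp: KG_hat_def)
  qed
  moreover have "supp (u - v) \<subseteq> supp u \<union> supp v"
    by (auto simp: supp_def)
  then have "supp (u - v) \<subseteq> G"
    using assms unfolding KG_hat_def by blast
  ultimately show ?thesis by (simp add: KG_hat_def)
qed

lemma KG_hat_zero: "(0 :: 'g \<Rightarrow> 'k::field) \<in> KG_hat G d"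
  by (simp add: KG_hat_def supp_def)

lemma KG_hat_add:
  fixes u v :: "'g \<Rightarrow> 'k::field"
  assumes "u \<in> KG_hat G d" "v \<in> KG_hat G d"
  shows "u + v \<in> KG_hat G d"
  using KG_hat_diff[OF assms(1) KG_hat_diff[OF KG_hat_zero assms(2)]] by simp

lemma KG_hat_smul:
  fixes v :: "'g \<Rightarrow> 'k::field"
  assumes "v \<in> KG_hat G d"
  shows "smul c v \<in> KG_hat G d"
proof -
  have "supp (smul c v) \<subseteq> supp v" by (auto simp: supp_def)
  moreover from this have "{g \<in> supp (smul c v). \<epsilon> \<le> d g} \<subseteq> {g \<in> supp v. \<epsilon> \<le> d g}" for \<epsilon>
    by blast
  ultimately show ?thesis
    using assms unfolding KG_hat_def by (blast intro: finite_subset)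
qed

lemma subspace_KG_hat: "vec.subspace (KG_hat G d :: ('g \<Rightarrow> 'k::field) set)"
  by (rule vec.subspaceI) (auto intro: KG_hat_zero KG_hat_add KG_hat_smul)

lemma delta_attained:
  fixes u v :: "'g \<Rightarrow> 'k::field"
  assumes pos: "\<And>g. g \<in> G \<Longrightarrow> d g > 0"
    and "u \<in> KG_hat G d" "v \<in> KG_hat G d" "u \<noteq> v"
  shows "\<exists>g\<in>G. u g \<noteq> v g \<and> delta G d u v = d g \<and> (\<forall>h. u h \<noteq> v h \<longrightarrow> d h \<le> d g)"
proof -
  obtain g0 where g0: "u g0 \<noteq> v g0" using assms by auto
  have w: "u - v \<in> KG_hat G d" using assms by (intro KG_hat_diff)
  have "g0 \<in> G" using KG_hatD[OF w, of g0] g0 by simp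
  hence "d g0 > 0" by (rule pos)
  let ?A = "{g \<in> supp (u - v). d g0 \<le> d g}"
  have fin: "finite ?A" using w \<open>d g0 > 0\<close> by (simp add: KG_hat_def)
  have ne: "g0 \<in> ?A" using g0 by (simp add: supp_def)
  have "Max (d ` ?A) \<in> d ` ?A" using fin ne by (intro Max_in) auto
  then obtain g where g: "g \<in> ?A" "d g = Max (d ` ?A)" by auto
  have le: "d h \<le> d g" if "u h \<noteq> v h" for h
  proof (cases "d g0 \<le> d h")
    case True
    hence "h \<in> ?A" using that by (simp add: supp_def)
    thus ?thesis using fin g by auto
  next
    case False
    thus ?thesis using g by auto
  qed
  have "Sup (d ` supp (u - v)) = d g"
  proof (rule cSup_eq_maximum)
    show "d g \<in> d ` supp (u - v)" using g(1) by blast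
  qed (use le in \<open>auto simp: supp_def\<close>)
  hence "delta G d u v = d g" using assms by (simp add: delta_def)
  moreover have "g \<in> G" using KG_hatD[OF w, of g] g by (auto simp: supp_def)
  ultimately show ?thesis using g le by (auto simp: supp_def)
qed

lemma delta_KG:
  fixes u v :: "'g \<Rightarrow> 'k::field"
  assumes "u \<in> KG G" "v \<in> KG G" "u \<noteq> v"
  shows "delta G d u v = Max {d g | g. (u - v) g \<noteq> 0}"
proof -
  have "u \<in> KG_hat G d" "v \<in> KG_hat G d" using assms KG_subset_KG_hat by blast+
  hence "delta G d u v = Sup (d ` supp (u - v))" using assms by (simp add: delta_def)
  moreover have "finite (supp (u - v))"
    by (rule finite_subset[of _ "supp u \<union> supp v"]) (use assms in \<open>auto simp: KG_def supp_def\<close>)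
  moreover have "supp (u - v) \<noteq> {}" using assms by (auto simp: supp_def fun_eq_iff)
  moreover have "{d g | g. (u - v) g \<noteq> 0} = d ` supp (u - v)" by (auto simp: supp_def)
  ultimately show ?thesis by (simp add: cSup_eq_Max)
qed

lemma delta_less_iff:
  fixes u v :: "'g \<Rightarrow> 'k::field"
  assumes pos: "\<And>g. g \<in> G \<Longrightarrow> d g > 0"
    and "u \<in> KG_hat G d" "v \<in> KG_hat G d" "\<epsilon> > 0"
  shows "delta G d u v < \<epsilon> \<longleftrightarrow> (\<forall>g. u g \<noteq> v g \<longrightarrow> d g < \<epsilon>)"
proof (cases "u = v")
  case True
  thus ?thesis using assms by (simp add: delta_def)
next
  case False
  obtain g where "u g \<noteq> v g" "delta G d u v = d g" "\<And>h. u h \<noteq> v h \<Longrightarrow> d h \<le> d g"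
    using delta_attained[OF pos assms(2,3) False] by blast
  thus ?thesis by fastforce
qed

lemma Metric_space_KG_hat:
  assumes pos: "\<And>g. g \<in> G \<Longrightarrow> d g > 0"
  shows "Metric_space (KG_hat G d) (delta G d :: ('g \<Rightarrow> 'k::field) \<Rightarrow> _)"
proof
  fix u v w :: "'g \<Rightarrow> 'k"
  show nn: "0 \<le> delta G d u v" for u v :: "'g \<Rightarrow> 'k"
  proof (cases "u \<in> KG_hat G d \<and> v \<in> KG_hat G d \<and> u \<noteq> v")
    case True
    then have "\<exists>g\<in>G. delta G d u v = d g"
      using delta_attained[of G d u v, OF pos] by blast
    then obtain g where "g \<in> G" "delta G d u v = d g" by blast
    thus ?thesis using pos[of g] by simp
  qed (auto simp: delta_def)
  have "supp (u - v) = supp (v - u)" by (auto simp: supp_def)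
  thus "delta G d u v = delta G d v u" by (auto simp: delta_def)
  show "delta G d u v = 0 \<longleftrightarrow> u = v" if "u \<in> KG_hat G d" "v \<in> KG_hat G d"
  proof
    assume 0: "delta G d u v = 0"
    show "u = v"
    proof (rule ccontr)
      assume "u \<noteq> v"
      then have "\<exists>g\<in>G. delta G d u v = d g"
        using delta_attained[of G d u v, OF pos that] by blast
      then obtain g where "g \<in> G" "delta G d u v = d g" by blast
      thus False using pos[of g] 0 by simp
    qed
  qed (simp add: delta_def)
  show "delta G d u w \<le> delta G d u v + delta G d v w"
    if H: "u \<in> KG_hat G d" "v \<in> KG_hat G d" "w \<in> KG_hat G d"
  proof (cases "u = w")
    case True
    thus ?thesis using nn[of u v] nn[of v w] by (simp add: delta_def)
  next
    case False
    then have "\<exists>g\<in>G. u g \<noteq> w g \<and> delta G d u w = d g"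
      using delta_attained[of G d u w, OF pos H(1,3)] by blast
    then obtain g where g: "g \<in> G" "u g \<noteq> w g" "delta G d u w = d g" by blast
    have *: "d g \<le> delta G d x y" if "x \<in> KG_hat G d" "y \<in> KG_hat G d" "x g \<noteq> y g" for x y :: "'g \<Rightarrow> 'k"
    proof -
      from that(3) have "x \<noteq> y" by blast
      from delta_attained[OF pos that(1,2) this] that(3) show ?thesis by auto
    qed
    show ?thesis
    proof (cases "u g = v g")
      case True
      hence "d g \<le> delta G d v w" using *[of v w] H g(2) by simp
      thus ?thesis using g(3) nn[of u v] by linarith
    next
      case False
      hence "d g \<le> delta G d u v" using *[of u v] H by simp
      thus ?thesis using g(3) nn[of v w] by linarith
    qed
  qed
qed

lemma mcomplete_KG_hat:
  assumes pos: "\<And>g. g \<in> G \<Longrightarrow> d g > 0"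
  shows "Metric_space.mcomplete (KG_hat G d) (delta G d :: ('g \<Rightarrow> 'k::field) \<Rightarrow> _)"
proof -
  interpret Metric_space "KG_hat G d" "delta G d :: ('g \<Rightarrow> 'k) \<Rightarrow> _"
    using pos by (rule Metric_space_KG_hat)
  show ?thesis
    unfolding mcomplete_def
  proof (intro allI impI)
    fix \<sigma> :: "nat \<Rightarrow> 'g \<Rightarrow> 'k"
    assume "MCauchy \<sigma>"
    hence mem: "\<And>n. \<sigma> n \<in> KG_hat G d"
      and "\<forall>\<epsilon>>0. \<exists>N. \<forall>n n'. N \<le> n \<longrightarrow> N \<le> n' \<longrightarrow> delta G d (\<sigma> n) (\<sigma> n') < \<epsilon>"
      by (auto simp: MCauchy_def)
    then obtain N where N: "\<And>\<epsilon> n n'. \<epsilon> > 0 \<Longrightarrow> N \<epsilon> \<le> n \<Longrightarrow> N \<epsilon> \<le> n' \<Longrightarrow>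
        delta G d (\<sigma> n) (\<sigma> n') < \<epsilon>"
      by metis
    have agree: "\<sigma> n g = \<sigma> n' g" if "\<epsilon> > 0" "N \<epsilon> \<le> n" "N \<epsilon> \<le> n'" "\<epsilon> \<le> d g" for \<epsilon> n n' g
      using N[OF that(1-3)] delta_less_iff[of G d "\<sigma> n" "\<sigma> n'" \<epsilon>] pos mem that by force
    define v where "v = (\<lambda>g. \<sigma> (N (d g)) g)"
    have v_eq: "v g = \<sigma> n g" if "\<epsilon> > 0" "N \<epsilon> \<le> n" "\<epsilon> \<le> d g" for \<epsilon> n g
    proof -
      have "v g = \<sigma> (max (N \<epsilon>) (N (d g))) g"
        unfolding v_def by (rule agree[of "d g"]) (use that in auto)
      also have "\<dots> = \<sigma> n g" by (rule agree[of \<epsilon>]) (use that in auto)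
      finally show ?thesis .
    qed
    have v: "v \<in> KG_hat G d"
      unfolding KG_hat_def
    proof (intro CollectI conjI allI impI)
      show "supp v \<subseteq> G" using KG_hatD[OF mem] unfolding v_def supp_def by blast
      fix \<epsilon> :: real assume "\<epsilon> > 0"
      hence "{g \<in> supp v. \<epsilon> \<le> d g} = {g \<in> supp (\<sigma> (N \<epsilon>)). \<epsilon> \<le> d g}"
        using v_eq[of \<epsilon> "N \<epsilon>"] unfolding supp_def by (intro Collect_cong) auto
      thus "finite {g \<in> supp v. \<epsilon> \<le> d g}" using mem \<open>\<epsilon> > 0\<close> by (simp add: KG_hat_def)
    qed
    have "limitin mtopology \<sigma> v sequentially"
      unfolding limitin_metric eventually_sequentially
    proof (intro conjI allI impI v)
      fix \<epsilon> :: real assume "\<epsilon> > 0"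
      have "delta G d (\<sigma> n) v < \<epsilon>" if "N \<epsilon> \<le> n" for n
    proof -
      have "\<forall>g. \<sigma> n g \<noteq> v g \<longrightarrow> d g < \<epsilon>"
        by (intro allI impI, rule ccontr) (simp add: not_less v_eq[OF \<open>\<epsilon> > 0\<close> that])
      thus ?thesis
        using delta_less_iff[of G d "\<sigma> n" v \<epsilon>] pos mem v \<open>\<epsilon> > 0\<close> by blast
    qed
      thus "\<exists>M. \<forall>n\<ge>M. \<sigma> n \<in> KG_hat G d \<and> delta G d (\<sigma> n) v < \<epsilon>" using mem by blast
    qed
    thus "\<exists>x. limitin mtopology \<sigma> x sequentially" by blast
  qed
qed

lemma KG_dense:
  assumes pos: "\<And>g. g \<in> G \<Longrightarrow> d g > 0"
  shows "Abstract_Topology.closure_of (hat_topology G d) (KG G :: ('g \<Rightarrow> 'k::field) set) = KG_hat G d"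
proof -
  interpret Metric_space "KG_hat G d" "delta G d :: ('g \<Rightarrow> 'k) \<Rightarrow> _"
    using pos by (rule Metric_space_KG_hat)
  have "\<exists>w\<in>KG G. w \<in> mball v \<epsilon>" if v: "v \<in> KG_hat G d" and "\<epsilon> > 0" for v :: "'g \<Rightarrow> 'k" and \<epsilon>
  proof
    let ?w = "\<lambda>g. if \<epsilon> \<le> d g then v g else 0"
    have "supp ?w = {g \<in> supp v. \<epsilon> \<le> d g}" by (auto simp: supp_def)
    thus w: "?w \<in> KG G" using v \<open>\<epsilon> > 0\<close> by (auto simp: KG_def KG_hat_def)
    hence w': "?w \<in> KG_hat G d" using KG_subset_KG_hat by blast
    show "?w \<in> mball v \<epsilon>"
      using delta_less_iff[of G d v ?w \<epsilon>] pos v w' \<open>\<epsilon> > 0\<close> by auto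
  qed
  thus ?thesis
    unfolding hat_topology_def metric_closure_of by auto
qed

lemma continuous_map_coeff:
  assumes pos: "\<And>g. g \<in> G \<Longrightarrow> d g > 0" and "g \<in> G"
  shows "continuous_map (hat_topology G d) (discrete_topology UNIV) (\<lambda>v :: 'g \<Rightarrow> 'k::field. v g)"
proof -
  interpret Metric_space "KG_hat G d" "delta G d :: ('g \<Rightarrow> 'k) \<Rightarrow> _"
    using pos by (rule Metric_space_KG_hat)
  have "openin mtopology {v \<in> KG_hat G d. v g \<in> U}" for U :: "'k set"
    unfolding openin_mtopology
  proof (intro conjI allI impI)
    fix v :: "'g \<Rightarrow> 'k" assume v: "v \<in> {v \<in> KG_hat G d. v g \<in> U}"
    have "mball v (d g) \<subseteq> {v \<in> KG_hat G d. v g \<in> U}"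
    proof
      fix w assume w: "w \<in> mball v (d g)"
      hence "w \<in> KG_hat G d" "delta G d v w < d g" by auto
      moreover from this have "v g = w g"
        using delta_less_iff[of G d v w "d g"] pos pos[OF assms(2)] v by blast
      ultimately show "w \<in> {v \<in> KG_hat G d. v g \<in> U}" using v by simp
    qed
    thus "\<exists>\<epsilon>>0. mball v \<epsilon> \<subseteq> {v \<in> KG_hat G d. v g \<in> U}" using pos assms(2) by blast
  qed auto
  thus ?thesis by (simp add: continuous_map_def hat_topology_def)
qed

lemma continuous_map_add:
  assumes pos: "\<And>g. g \<in> G \<Longrightarrow> d g > 0"
  shows "continuous_map (prod_topology (hat_topology G d) (hat_topology G d)) (hat_topology G d)
           (\<lambda>(u, v). u + v :: 'g \<Rightarrow> 'k::field)"
proof -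
  interpret Metric_space "KG_hat G d" "delta G d :: ('g \<Rightarrow> 'k) \<Rightarrow> _"
    using pos by (rule Metric_space_KG_hat)
  show ?thesis
    unfolding hat_topology_def continuous_map_to_metric
  proof (clarsimp)
    fix u v :: "'g \<Rightarrow> 'k" and \<epsilon> :: real
    assume u: "u \<in> KG_hat G d" and v: "v \<in> KG_hat G d" and e: "\<epsilon> > 0"
    have "u' + v' \<in> mball (u + v) \<epsilon>" if "u' \<in> mball u \<epsilon>" "v' \<in> mball v \<epsilon>" for u' v'
    proof -
      from that have m: "u' \<in> KG_hat G d" "v' \<in> KG_hat G d" by auto
      have "\<forall>g. u g \<noteq> u' g \<longrightarrow> d g < \<epsilon>" "\<forall>g. v g \<noteq> v' g \<longrightarrow> d g < \<epsilon>"
        using that delta_less_iff[of G d u u' \<epsilon>] delta_less_iff[of G d v v' \<epsilon>] pos u v m e by auto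
      hence "\<forall>g. (u + v) g \<noteq> (u' + v') g \<longrightarrow> d g < \<epsilon>" by (metis plus_fun_apply)
      thus ?thesis
        using delta_less_iff[OF pos KG_hat_add[OF u v] KG_hat_add[OF m] e]
          KG_hat_add[OF u v] KG_hat_add[OF m] by (simp del: plus_fun_apply)
    qed
    hence "openin (prod_topology mtopology mtopology) (mball u \<epsilon> \<times> mball v \<epsilon>) \<and>
           (u, v) \<in> mball u \<epsilon> \<times> mball v \<epsilon> \<and>
           (\<forall>p \<in> mball u \<epsilon> \<times> mball v \<epsilon>. (\<lambda>(u, v). u + v) p \<in> mball (u + v) \<epsilon>)"
      using u v e by (auto simp: openin_prod_Times_iff simp del: in_mball)
    thus "\<exists>U. openin (prod_topology mtopology mtopology) U \<and> (u, v) \<in> U \<and>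
           (\<forall>y\<in>U. u + v \<in> KG_hat G d \<and> (case y of (u, v) \<Rightarrow> u + v) \<in> KG_hat G d \<and>
              delta G d (u + v) (case y of (u, v) \<Rightarrow> u + v) < \<epsilon>)"
      unfolding in_mball by meson
  qed
qed

lemma continuous_map_smul:
  assumes pos: "\<And>g. g \<in> G \<Longrightarrow> d g > 0"
  shows "continuous_map (prod_topology (discrete_topology UNIV) (hat_topology G d)) (hat_topology G d)
           (\<lambda>(c, v). smul c v :: 'g \<Rightarrow> 'k::field)"
proof -
  interpret Metric_space "KG_hat G d" "delta G d :: ('g \<Rightarrow> 'k) \<Rightarrow> _"
    using pos by (rule Metric_space_KG_hat)
  show ?thesis
    unfolding hat_topology_def continuous_map_to_metric
  proof (clarsimp)
    fix c :: 'k and v :: "'g \<Rightarrow> 'k" and \<epsilon> :: real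
    assume v: "v \<in> KG_hat G d" and e: "\<epsilon> > 0"
    have "smul c v' \<in> mball (smul c v) \<epsilon>" if "v' \<in> mball v \<epsilon>" for v'
    proof -
      from that have m: "v' \<in> KG_hat G d" by auto
      have "\<forall>g. v g \<noteq> v' g \<longrightarrow> d g < \<epsilon>"
        using that delta_less_iff[of G d v v' \<epsilon>] pos v m e by auto
      hence "\<forall>g. smul c v g \<noteq> smul c v' g \<longrightarrow> d g < \<epsilon>" by (metis smul_apply)
      thus ?thesis
        using delta_less_iff[OF pos KG_hat_smul[OF v] KG_hat_smul[OF m] e]
          KG_hat_smul[OF v] KG_hat_smul[OF m] by (simp del: smul_apply)
    qed
    hence "openin (prod_topology (discrete_topology UNIV) mtopology) ({c} \<times> mball v \<epsilon>) \<and>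
           (c, v) \<in> {c} \<times> mball v \<epsilon> \<and>
           (\<forall>p \<in> {c} \<times> mball v \<epsilon>. (\<lambda>(c, v). smul c v) p \<in> mball (smul c v) \<epsilon>)"
      using v e by (auto simp: openin_prod_Times_iff simp del: in_mball)
    thus "\<exists>U. openin (prod_topology (discrete_topology UNIV) mtopology) U \<and> (c, v) \<in> U \<and>
           (\<forall>y\<in>U. smul c v \<in> KG_hat G d \<and> (case y of (c, v) \<Rightarrow> smul c v) \<in> KG_hat G d \<and>
              delta G d (smul c v) (case y of (c, v) \<Rightarrow> smul c v) < \<epsilon>)"
      unfolding in_mball by meson
  qed
qed

end

theory Submission
  imports Defs
begin

text \<open>
  A nonzero series in \<open>KG_hat G d\<close> has a greatest term in its support: only finitely many terms
  have weight at least that of a given term, and all the others are smaller for the order because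
  \<open>d\<close> is non-decreasing.  Let \<open>V\<close> be a closed subspace and let \<open>LM V\<close> be the set of leading
  terms of the nonzero elements of \<open>V\<close>.  Everything rests on the decomposition
  \<open>KG_hat G d = V \<oplus> {w. w vanishes on LM V}\<close>.  The sum is direct since a nonzero element of \<open>V\<close>
  does not vanish at its leading term.

  To decompose \<open>u\<close>, one kills the coefficients of \<open>u\<close> at \<open>LM V\<close> by subtracting multiples of
  elements of \<open>V\<close>, as in Gaussian elimination.  Inside one level the greatest coefficient to be
  killed strictly decreases at each step, so well-ordering of the level makes the elimination stop
  (\<open>eliminate_level\<close>).  Treating level \<open>n\<close> only disturbs terms of weight \<open>< 1 / (n - 1)\<close>,
  so the successive remainders converge, and the difference between \<open>u\<close> and the limit lies in \<open>V\<close>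
  because \<open>V\<close> is closed (\<open>normal_form_exists\<close>).

  The projection onto the second summand along \<open>V\<close> is linear with kernel \<open>V\<close>.  Each term of the
  normal form of \<open>u\<close> is bounded by a term of \<open>u\<close> (\<open>normal_form_bounded\<close>); this gives continuity
  and the rewriting condition at once, so the projection is a reduction operator.

  Conversely, for a reduction operator \<open>T\<close> with kernel \<open>V\<close>, the terms that \<open>T\<close> moves are exactly
  those of \<open>LM V\<close>, and the image of \<open>T\<close> vanishes on them (\<open>RO_is_normal_form\<close>).  Hence \<open>T\<close> is the
  projection above and is determined by its kernel.  The lattice structure is transported from
  closed subspaces ordered by reverse inclusion.
\<close>

section \<open>Topology in terms of coefficients\<close>

locale weighted_set =
  fixes G :: "'g set" and d :: "'g \<Rightarrow> real"
  assumes weight_pos: "\<And>g. g \<in> G \<Longrightarrow> d g > 0"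
begin

lemma delta_less_iff':
  fixes u v :: "'g \<Rightarrow> 'k::field"
  assumes "u \<in> KG_hat G d" "v \<in> KG_hat G d" "\<epsilon> > 0"
  shows "delta G d u v < \<epsilon> \<longleftrightarrow> (\<forall>g. \<epsilon> \<le> d g \<longrightarrow> u g = v g)"
  using delta_less_iff[OF weight_pos assms] by (meson not_le)

text \<open>
  A ball of radius \<open>\<epsilon>\<close> consists of the series with the same coefficients in weight \<open>\<ge> \<epsilon>\<close>, so
  closures can be handled by comparing coefficients.
\<close>

lemma closure_iff:
  fixes S :: "('g \<Rightarrow> 'k::field) set"
  assumes "S \<subseteq> KG_hat G d"
  shows "u \<in> Abstract_Topology.closure_of (hat_topology G d) S \<longleftrightarrow>
    u \<in> KG_hat G d \<and> (\<forall>\<epsilon>>0. \<exists>v\<in>S. \<forall>g. \<epsilon> \<le> d g \<longrightarrow> u g = v g)"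
proof -
  interpret Metric_space "KG_hat G d" "delta G d :: ('g \<Rightarrow> 'k) \<Rightarrow> _"
    using weight_pos by (rule Metric_space_KG_hat)
  have "v \<in> mball u \<epsilon> \<longleftrightarrow> (\<forall>g. \<epsilon> \<le> d g \<longrightarrow> u g = v g)"
    if "u \<in> KG_hat G d" "v \<in> S" "\<epsilon> > 0" for v \<epsilon>
    using delta_less_iff'[of u v \<epsilon>] that assms by auto
  then show ?thesis
    unfolding hat_topology_def metric_closure_of by (auto simp del: in_mball)
qed

lemma closed_subspace_limit:
  fixes V :: "('g \<Rightarrow> 'k::field) set"
  assumes "V \<in> closed_subspaces G d" "u \<in> KG_hat G d"
    and "\<And>\<epsilon>. \<epsilon> > 0 \<Longrightarrow> \<exists>v\<in>V. \<forall>g. \<epsilon> \<le> d g \<longrightarrow> u g = v g"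
  shows "u \<in> V"
proof -
  have V: "V \<subseteq> KG_hat G d" "closedin (hat_topology G d) V"
    using assms(1) by (auto simp: closed_subspaces_def)
  have "u \<in> Abstract_Topology.closure_of (hat_topology G d) V"
    using closure_iff[OF V(1)] assms by blast
  then show ?thesis using closure_of_closedin[OF V(2)] by simp
qed

lemma closure_subspace:
  fixes S :: "('g \<Rightarrow> 'k::field) set"
  assumes S: "S \<subseteq> KG_hat G d" "vec.subspace S"
  shows "Abstract_Topology.closure_of (hat_topology G d) S \<in> closed_subspaces G d"
proof -
  let ?C = "Abstract_Topology.closure_of (hat_topology G d) S"
  note iff = closure_iff[OF S(1)]
  have "vec.subspace ?C"
  proof (rule vec.subspaceI)
    show "0 \<in> ?C" using KG_hat_zero vec.subspace_0[OF S(2)] unfolding iff by blast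
  next
    fix u v assume "u \<in> ?C" "v \<in> ?C"
    then have uv: "u \<in> KG_hat G d" "v \<in> KG_hat G d"
      and app: "\<And>\<epsilon>. \<epsilon> > 0 \<Longrightarrow> \<exists>u'\<in>S. \<forall>g. \<epsilon> \<le> d g \<longrightarrow> u g = u' g"
        "\<And>\<epsilon>. \<epsilon> > 0 \<Longrightarrow> \<exists>v'\<in>S. \<forall>g. \<epsilon> \<le> d g \<longrightarrow> v g = v' g"
      unfolding iff by blast+
    have "\<exists>w\<in>S. \<forall>g. \<epsilon> \<le> d g \<longrightarrow> (u + v) g = w g" if e: "\<epsilon> > 0" for \<epsilon>
    proof -
      obtain u' v' where uv': "u' \<in> S" "v' \<in> S"
        "\<forall>g. \<epsilon> \<le> d g \<longrightarrow> u g = u' g" "\<forall>g. \<epsilon> \<le> d g \<longrightarrow> v g = v' g"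
        using app[OF e] by blast
      then have "\<forall>g. \<epsilon> \<le> d g \<longrightarrow> (u + v) g = (u' + v') g" by simp
      then show ?thesis using vec.subspace_add[OF S(2) uv'(1,2)] by blast
    qed
    then show "u + v \<in> ?C" using KG_hat_add[OF uv] unfolding iff by blast
  next
    fix c u assume "u \<in> ?C"
    then have u: "u \<in> KG_hat G d"
      and app: "\<And>\<epsilon>. \<epsilon> > 0 \<Longrightarrow> \<exists>u'\<in>S. \<forall>g. \<epsilon> \<le> d g \<longrightarrow> u g = u' g"
      unfolding iff by blast+
    have "\<exists>w\<in>S. \<forall>g. \<epsilon> \<le> d g \<longrightarrow> smul c u g = w g" if e: "\<epsilon> > 0" for \<epsilon>
    proof -
      obtain u' where u': "u' \<in> S" "\<forall>g. \<epsilon> \<le> d g \<longrightarrow> u g = u' g"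
        using app[OF e] by blast
      then have "\<forall>g. \<epsilon> \<le> d g \<longrightarrow> smul c u g = smul c u' g" by simp
      then show ?thesis using vec.subspace_scale[OF S(2) u'(1)] by blast
    qed
    then show "smul c u \<in> ?C" using KG_hat_smul[OF u] unfolding iff by blast
  qed
  moreover have "?C \<subseteq> KG_hat G d" using iff by blast
  ultimately show ?thesis by (simp add: closed_subspaces_def)
qed

lemma closure_sum_closed_subspace:
  fixes V W :: "('g \<Rightarrow> 'k::field) set"
  assumes "V \<in> closed_subspaces G d" "W \<in> closed_subspaces G d"
  shows "closure_sum G d V W \<in> closed_subspaces G d"
proof -
  have "vec.subspace {v + w | v w. v \<in> V \<and> w \<in> W}"
    using assms vec.subspace_sums[of V W] by (auto simp: closed_subspaces_def)
  moreover have "{v + w | v w. v \<in> V \<and> w \<in> W} \<subseteq> KG_hat G d"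
    using assms KG_hat_add by (fastforce simp: closed_subspaces_def)
  ultimately show ?thesis unfolding closure_sum_def by (intro closure_subspace)
qed

text \<open>
  The order on operators reverses inclusion of kernels, so this universal property of the closed
  sum is what produces greatest lower bounds.
\<close>

lemma closure_sum_subset_iff:
  fixes U V W :: "('g \<Rightarrow> 'k::field) set"
  assumes U: "U \<in> closed_subspaces G d"
    and V: "V \<in> closed_subspaces G d" and W: "W \<in> closed_subspaces G d"
  shows "closure_sum G d V W \<subseteq> U \<longleftrightarrow> V \<subseteq> U \<and> W \<subseteq> U"
proof
  let ?S = "{v + w | v w. v \<in> V \<and> w \<in> W}"
  have sub: "vec.subspace U" "vec.subspace V" "vec.subspace W"
    and hat: "V \<subseteq> KG_hat G d" "W \<subseteq> KG_hat G d" and cl: "closedin (hat_topology G d) U"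
    using assms by (auto simp: closed_subspaces_def)
  have S_hat: "?S \<subseteq> KG_hat G d"
    using hat KG_hat_add by fastforce
  have S: "?S \<subseteq> closure_sum G d V W"
    unfolding closure_sum_def using closure_iff[OF S_hat] S_hat by blast
  have "v + 0 \<in> ?S" if "v \<in> V" for v using that vec.subspace_0[OF sub(3)] by blast
  moreover have "0 + w \<in> ?S" if "w \<in> W" for w using that vec.subspace_0[OF sub(2)] by blast
  ultimately have VW: "V \<subseteq> ?S" "W \<subseteq> ?S" by auto
  show "V \<subseteq> U \<and> W \<subseteq> U" if "closure_sum G d V W \<subseteq> U"
    using that S VW by blast
  show "closure_sum G d V W \<subseteq> U" if "V \<subseteq> U \<and> W \<subseteq> U"
    unfolding closure_sum_def
    by (rule closure_of_minimal[OF _ cl]) (use that vec.subspace_add[OF sub(1)] in blast)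
qed

lemma Int_closed_subspace:
  fixes V W :: "('g \<Rightarrow> 'k::field) set"
  assumes "V \<in> closed_subspaces G d" "W \<in> closed_subspaces G d"
  shows "V \<inter> W \<in> closed_subspaces G d"
  using assms by (auto simp: closed_subspaces_def intro: vec.subspace_inter closedin_Int)

text \<open>
  By additivity it suffices to test continuity at \<open>0\<close>, where it holds as soon as an operator does
  not increase the largest weight in the support.
\<close>

lemma continuous_if_weight_nonincreasing:
  fixes T :: "('g \<Rightarrow> 'k::field) \<Rightarrow> ('g \<Rightarrow> 'k)"
  assumes hat: "\<And>u. u \<in> KG_hat G d \<Longrightarrow> T u \<in> KG_hat G d"
    and diff: "\<And>u v. u \<in> KG_hat G d \<Longrightarrow> v \<in> KG_hat G d \<Longrightarrow> T (u - v) = T u - T v"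
    and weight: "\<And>u \<epsilon>. u \<in> KG_hat G d \<Longrightarrow> \<epsilon> > 0 \<Longrightarrow> \<forall>g. \<epsilon> \<le> d g \<longrightarrow> u g = 0 \<Longrightarrow>
        \<forall>g. \<epsilon> \<le> d g \<longrightarrow> T u g = 0"
  shows "continuous_map (hat_topology G d) (hat_topology G d) T"
proof -
  interpret Metric_space "KG_hat G d" "delta G d :: ('g \<Rightarrow> 'k) \<Rightarrow> _"
    using weight_pos by (rule Metric_space_KG_hat)
  show ?thesis
    unfolding hat_topology_def continuous_map_to_metric
  proof (intro ballI allI impI)
    fix u :: "'g \<Rightarrow> 'k" and \<epsilon> :: real
    assume "u \<in> topspace mtopology" and e: "\<epsilon> > 0"
    then have u: "u \<in> KG_hat G d" by simp
    have "T v \<in> mball (T u) \<epsilon>" if v: "v \<in> mball u \<epsilon>" for v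
    proof -
      have v': "v \<in> KG_hat G d" and "delta G d u v < \<epsilon>" using v by auto
      then have "\<forall>g. \<epsilon> \<le> d g \<longrightarrow> (u - v) g = 0" using delta_less_iff'[OF u v' e] by simp
      then have "\<forall>g. \<epsilon> \<le> d g \<longrightarrow> T (u - v) g = 0" by (intro weight KG_hat_diff u v' e)
      then have "\<forall>g. \<epsilon> \<le> d g \<longrightarrow> T u g = T v g" unfolding diff[OF u v'] by simp
      then show ?thesis using delta_less_iff'[OF hat[OF u] hat[OF v'] e] hat u v' by simp
    qed
    then show "\<exists>U. openin mtopology U \<and> u \<in> U \<and> (\<forall>y\<in>U. T y \<in> mball (T u) \<epsilon>)"
      using u e by (intro exI[of _ "mball u \<epsilon>"]) auto
  qed
qed

lemma basis_vec_hat: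
  assumes "g \<in> G"
  shows "(basis_vec g :: 'g \<Rightarrow> 'k::field) \<in> KG_hat G d"
proof -
  have "supp (basis_vec g :: 'g \<Rightarrow> 'k) = {g}" by (auto simp: supp_def basis_vec_def)
  then have "(basis_vec g :: 'g \<Rightarrow> 'k) \<in> KG G" using assms by (simp add: KG_def)
  then show ?thesis using KG_subset_KG_hat by blast
qed

section \<open>Continuous linear projectors\<close>

context
  fixes T :: "('g \<Rightarrow> 'k::field) \<Rightarrow> ('g \<Rightarrow> 'k)"
  assumes T: "continuous_linear_projector G d T"
begin

lemma projector_hat: "u \<in> KG_hat G d \<Longrightarrow> T u \<in> KG_hat G d"
  using T by (auto simp: continuous_linear_projector_def)

lemma projector_add: "u \<in> KG_hat G d \<Longrightarrow> v \<in> KG_hat G d \<Longrightarrow> T (u + v) = T u + T v"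
  using T by (auto simp: continuous_linear_projector_def)

lemma projector_smul: "u \<in> KG_hat G d \<Longrightarrow> T (smul c u) = smul c (T u)"
  using T by (auto simp: continuous_linear_projector_def)

lemma projector_idem: "u \<in> KG_hat G d \<Longrightarrow> T (T u) = T u"
  using T by (auto simp: continuous_linear_projector_def)

lemma projector_zero: "T 0 = 0"
  using projector_add[OF KG_hat_zero KG_hat_zero] by simp

lemma projector_diff:
  assumes "u \<in> KG_hat G d" "v \<in> KG_hat G d"
  shows "T (u - v) = T u - T v"
  using projector_add[OF KG_hat_diff[OF assms] assms(2)] by simp

lemma ker_closed_subspace: "ker G d T \<in> closed_subspaces G d"
proof -
  interpret Metric_space "KG_hat G d" "delta G d :: ('g \<Rightarrow> 'k) \<Rightarrow> _"
    using weight_pos by (rule Metric_space_KG_hat)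
  have "closedin (hat_topology G d) {0 :: 'g \<Rightarrow> 'k}"
    unfolding hat_topology_def
    by (rule closedin_Hausdorff_singleton) (simp_all add: Hausdorff_space_mtopology KG_hat_zero)
  then have "closedin (hat_topology G d) {v \<in> topspace (hat_topology G d). T v \<in> {0}}"
    using T closedin_continuous_map_preimage by (fastforce simp: continuous_linear_projector_def)
  then have "closedin (hat_topology G d) (ker G d T)"
    by (simp add: ker_def hat_topology_def)
  moreover have "vec.subspace (ker G d T)"
    by (rule vec.subspaceI)
      (auto simp: ker_def KG_hat_zero projector_zero projector_add projector_smul
        intro: KG_hat_add KG_hat_smul)
  ultimately show ?thesis by (auto simp: closed_subspaces_def ker_def)
qed

text \<open>
  This is how the values of \<open>T\<close> on the basis control \<open>T w\<close>: only finitely many terms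
  of \<open>w\<close> can contribute to the coefficient of \<open>T w\<close> at \<open>g\<close>, since by continuity those of small weight do not.
\<close>

lemma projector_coeff_zero:
  assumes w: "w \<in> KG_hat G d" and g: "g \<in> G"
    and coeff: "\<And>h. w h \<noteq> 0 \<Longrightarrow> T (basis_vec h) g = 0"
  shows "T w g = 0"
proof -
  interpret Metric_space "KG_hat G d" "delta G d :: ('g \<Rightarrow> 'k) \<Rightarrow> _"
    using weight_pos by (rule Metric_space_KG_hat)
  have "\<exists>U. openin mtopology U \<and> 0 \<in> U \<and> (\<forall>y\<in>U. T y \<in> mball (T 0) (d g))"
    using T weight_pos[OF g] KG_hat_zero[of G d]
    unfolding continuous_linear_projector_def hat_topology_def continuous_map_to_metric
      topspace_mtopology
    by blast
  then obtain \<epsilon> where e: "\<epsilon> > 0" "\<And>u. u \<in> mball 0 \<epsilon> \<Longrightarrow> T u \<in> mball 0 (d g)"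
    unfolding openin_mtopology projector_zero by (meson subsetD)
  have small: "T u g = 0" if u: "u \<in> KG_hat G d" "\<forall>h. \<epsilon> \<le> d h \<longrightarrow> u h = 0" for u
  proof -
    have "u \<in> mball 0 \<epsilon>"
      using delta_less_iff'[OF KG_hat_zero u(1) e(1)] u KG_hat_zero by simp
    then have "T u \<in> mball 0 (d g)" by (rule e(2))
    then show ?thesis
      using delta_less_iff'[OF KG_hat_zero projector_hat[OF u(1)] weight_pos[OF g]] by simp
  qed
  have fin: "T u g = 0" if "finite F" "u \<in> KG_hat G d" "supp u \<subseteq> F"
    "\<And>h. u h \<noteq> 0 \<Longrightarrow> T (basis_vec h) g = 0" for F u
    using that
  proof (induction F arbitrary: u rule: finite_induct)
    case empty
    then have "u = 0" by (auto simp: supp_def fun_eq_iff)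
    then have "T u = 0" by (simp only: projector_zero)
    then show ?case by simp
  next
    case (insert h F)
    show ?case
    proof (cases "u h = 0")
      case True
      then have "supp u \<subseteq> F" using insert.prems(2) by (auto simp: supp_def)
      then show ?thesis by (rule insert.IH[OF insert.prems(1) _ insert.prems(3)])
    next
      case False
      let ?b = "smul (u h) (basis_vec h)"
      have "h \<in> G" using KG_hatD insert.prems(1) False .
      then have bh: "(basis_vec h :: 'g \<Rightarrow> 'k) \<in> KG_hat G d" by (rule basis_vec_hat)
      then have b: "?b \<in> KG_hat G d" by (rule KG_hat_smul)
      have val: "(u - ?b) k = (if k = h then 0 else u k)" for k by (simp add: basis_vec_def)
      have "T (u - ?b) g = 0"
      proof (rule insert.IH)
        show "u - ?b \<in> KG_hat G d" by (rule KG_hat_diff[OF insert.prems(1) b])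
        show "supp (u - ?b) \<subseteq> F"
          using insert.prems(2) unfolding supp_def val by auto
        show "T (basis_vec k) g = 0" if "(u - ?b) k \<noteq> 0" for k
          using that insert.prems(3)[of k] unfolding val by (auto split: if_splits)
      qed
      then show ?thesis
        using projector_diff[OF insert.prems(1) b] projector_smul[OF bh] insert.prems(3)[OF False]
        by simp
    qed
  qed
  let ?w = "\<lambda>h. if \<epsilon> \<le> d h then w h else 0"
  have s: "supp ?w = {h \<in> supp w. \<epsilon> \<le> d h}" by (auto simp: supp_def)
  then have "?w \<in> KG G" using w e(1) by (auto simp: KG_def KG_hat_def)
  then have w1: "?w \<in> KG_hat G d" using KG_subset_KG_hat by blast
  have "T ?w g = 0"
  proof (rule fin[OF _ w1 order_refl])
    show "finite (supp ?w)" using s w e(1) by (simp add: KG_hat_def)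
    show "T (basis_vec h) g = 0" if "?w h \<noteq> 0" for h
      using that by (intro coeff) (simp split: if_splits)
  qed
  moreover have "T (w - ?w) g = 0" by (rule small[OF KG_hat_diff[OF w w1]]) simp
  ultimately show ?thesis using projector_diff[OF w w1] by simp
qed

end

end

section \<open>Leading terms and normal forms\<close>

definition leading :: "'g rel \<Rightarrow> ('g \<Rightarrow> 'k::zero) \<Rightarrow> 'g \<Rightarrow> bool" where
  "leading r v g \<longleftrightarrow> v g \<noteq> 0 \<and> (\<forall>h. v h \<noteq> 0 \<longrightarrow> (h, g) \<in> r)"

definition LM :: "'g rel \<Rightarrow> ('g \<Rightarrow> 'k::zero) set \<Rightarrow> 'g set" where
  "LM r V = {g. \<exists>v\<in>V. leading r v g}"

locale monotone_weight = weighted_set G d for G :: "'g set" and d +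
  fixes r :: "'g rel"
  assumes linear: "linear_order_on G r"
    and weight_mono: "\<And>g g'. g \<in> G \<Longrightarrow> g' \<in> G \<Longrightarrow> (g, g') \<in> r - Id \<Longrightarrow> d g \<le> d g'"
begin

lemma r_refl: "g \<in> G \<Longrightarrow> (g, g) \<in> r"
  and r_trans: "(a, b) \<in> r \<Longrightarrow> (b, c) \<in> r \<Longrightarrow> (a, c) \<in> r"
  and r_antisym: "(a, b) \<in> r \<Longrightarrow> (b, a) \<in> r \<Longrightarrow> a = b"
  and r_total: "a \<in> G \<Longrightarrow> b \<in> G \<Longrightarrow> (a, b) \<in> r \<or> (b, a) \<in> r"
  and r_field: "(a, b) \<in> r \<Longrightarrow> a \<in> G \<and> b \<in> G"
proof -
  have "refl_on G r" "trans r" "antisym r" "total_on G r" "r \<subseteq> G \<times> G"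
    using linear by (auto simp: order_on_defs)
  then show "g \<in> G \<Longrightarrow> (g, g) \<in> r"
    and "(a, b) \<in> r \<Longrightarrow> (b, c) \<in> r \<Longrightarrow> (a, c) \<in> r"
    and "(a, b) \<in> r \<Longrightarrow> (b, a) \<in> r \<Longrightarrow> a = b"
    and "(a, b) \<in> r \<Longrightarrow> a \<in> G \<and> b \<in> G"
    by (auto dest: refl_onD transD antisymD)
  show "(a, b) \<in> r \<or> (b, a) \<in> r" if "a \<in> G" "b \<in> G"
    using \<open>total_on G r\<close> \<open>refl_on G r\<close> that by (cases "a = b") (auto simp: total_on_def refl_on_def)
qed

lemma weight_le: "(g, g') \<in> r \<Longrightarrow> d g \<le> d g'"
  using weight_mono[of g g'] r_field by fastforce

lemma finite_has_greatest:
  assumes "finite A" "A \<noteq> {}" "A \<subseteq> G"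
  shows "\<exists>g\<in>A. \<forall>h\<in>A. (h, g) \<in> r"
  using assms
proof (induction rule: finite_ne_induct)
  case (singleton x)
  then show ?case using r_refl by auto
next
  case (insert x A)
  then obtain g where g: "g \<in> A" "\<forall>h\<in>A. (h, g) \<in> r" by auto
  have "(x, g) \<in> r \<or> (g, x) \<in> r" using r_total g insert.prems by auto
  then show ?case
  proof
    assume "(x, g) \<in> r"
    then show ?thesis using g by blast
  next
    assume *: "(g, x) \<in> r"
    then have "\<forall>h\<in>A. (h, x) \<in> r" using g r_trans by blast
    then show ?thesis using r_refl insert.prems by auto
  qed
qed

text \<open>
  Terms lighter than a given term of the support are smaller, and only finitely many are not
  lighter.
\<close>

lemma support_has_greatest:
  fixes v :: "'g \<Rightarrow> 'k::field"
  assumes v: "v \<in> KG_hat G d" and g0: "g0 \<in> A" "v g0 \<noteq> 0"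
  shows "\<exists>g\<in>A. v g \<noteq> 0 \<and> (\<forall>h\<in>A. v h \<noteq> 0 \<longrightarrow> (h, g) \<in> r)"
proof -
  have G: "h \<in> G" if "v h \<noteq> 0" for h using KG_hatD[OF v that] .
  let ?F = "{h \<in> A. v h \<noteq> 0 \<and> d g0 \<le> d h}"
  have "finite {h \<in> supp v. d g0 \<le> d h}"
    using v weight_pos[OF G[OF g0(2)]] by (simp add: KG_hat_def)
  then have "finite ?F" by (rule rev_finite_subset) (auto simp: supp_def)
  moreover have "?F \<noteq> {}" using g0 by auto
  moreover have "?F \<subseteq> G" using G by auto
  ultimately obtain g where g: "g \<in> ?F" "\<And>h. h \<in> ?F \<Longrightarrow> (h, g) \<in> r"
    using finite_has_greatest by meson
  have "(h, g) \<in> r" if h: "h \<in> A" "v h \<noteq> 0" for h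
  proof (cases "d g0 \<le> d h")
    case True
    then show ?thesis using h g(2) by simp
  next
    case False
    then have "\<not> d g \<le> d h" using g(1) by simp
    then show ?thesis using r_total[of g h] weight_le[of g h] G h g(1) by auto
  qed
  then show ?thesis using g(1) by auto
qed

lemma leading_exists:
  fixes v :: "'g \<Rightarrow> 'k::field"
  assumes "v \<in> KG_hat G d" "v h \<noteq> 0"
  shows "\<exists>g. leading r v g"
  using support_has_greatest[OF assms(1), of h UNIV] assms(2) unfolding leading_def by auto

text \<open>
  \<open>normal_form V u w\<close> says that \<open>w\<close> is a remainder of \<open>u\<close> modulo \<open>V\<close> that cannot be reduced
  further.
\<close>

definition normal_form :: "('g \<Rightarrow> 'k::field) set \<Rightarrow> ('g \<Rightarrow> 'k) \<Rightarrow> ('g \<Rightarrow> 'k) \<Rightarrow> bool" where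
  "normal_form V u w \<longleftrightarrow> w \<in> KG_hat G d \<and> u - w \<in> V \<and> (\<forall>g\<in>LM r V. w g = 0)"

context
  fixes V :: "('g \<Rightarrow> 'k::field) set"
  assumes V_hat: "V \<subseteq> KG_hat G d" and V_sub: "vec.subspace V"
begin

lemma zero_if_vanishes_on_LM:
  assumes "v \<in> V" "\<And>g. g \<in> LM r V \<Longrightarrow> v g = 0"
  shows "v = 0"
proof (rule ccontr)
  assume "v \<noteq> 0"
  then obtain h where "v h \<noteq> 0" by (auto simp: fun_eq_iff)
  then obtain g where "leading r v g" using leading_exists assms(1) V_hat by blast
  then show False using assms by (auto simp: LM_def leading_def)
qed

lemma normal_form_unique:
  assumes "normal_form V u w" "normal_form V u w'"
  shows "w = w'"
proof -
  have "(u - w') - (u - w) \<in> V"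
    using assms by (blast intro: vec.subspace_diff[OF V_sub] dest: normal_form_def[THEN iffD1])
  then have "w - w' \<in> V" by simp
  then have "w - w' = 0"
    by (rule zero_if_vanishes_on_LM) (use assms in \<open>auto simp: normal_form_def\<close>)
  then show ?thesis by simp
qed

lemma normal_form_add:
  assumes "normal_form V u w" "normal_form V u' w'"
  shows "normal_form V (u + u') (w + w')"
proof -
  have "(u - w) + (u' - w') \<in> V"
    using assms by (intro vec.subspace_add[OF V_sub]) (simp_all add: normal_form_def)
  then show ?thesis using assms by (auto simp: normal_form_def algebra_simps intro: KG_hat_add)
qed

lemma normal_form_smul:
  assumes "normal_form V u w"
  shows "normal_form V (smul c u) (smul c w)"
proof -
  have "smul c (u - w) \<in> V"
    using assms by (intro vec.subspace_scale[OF V_sub]) (simp_all add: normal_form_def)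
  then show ?thesis
    using assms by (auto simp: normal_form_def vec.scale_right_diff_distrib intro: KG_hat_smul)
qed

text \<open>
  If the greatest term of \<open>w\<close> does not occur in \<open>u\<close>, it occurs in \<open>u - w\<close>; the leading term of
  \<open>u - w\<close> is then at least as large, lies outside the support of \<open>w\<close>, and hence comes from \<open>u\<close>.
\<close>

lemma normal_form_bounded:
  assumes nf: "normal_form V u w" and h: "w h \<noteq> 0"
  shows "\<exists>g. u g \<noteq> 0 \<and> (h, g) \<in> r"
proof -
  have "w \<in> KG_hat G d" using nf by (simp add: normal_form_def)
  then obtain m where m: "w m \<noteq> 0" "(h, m) \<in> r"
    using leading_exists h unfolding leading_def by blast
  show ?thesis
  proof (cases "u m = 0")
    case False
    then show ?thesis using m by blast
  next
    case True
    then have "(u - w) m \<noteq> 0" using m by simp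
    moreover have v: "u - w \<in> V" using nf by (simp add: normal_form_def)
    ultimately obtain k where k: "leading r (u - w) k" "(m, k) \<in> r"
      using leading_exists[of "u - w" m] V_hat unfolding leading_def by blast
    then have "k \<in> LM r V" using v by (auto simp: LM_def)
    then have "u k \<noteq> 0" using nf k by (auto simp: normal_form_def leading_def)
    then show ?thesis using k(2) m(2) r_trans by blast
  qed
qed

end

section \<open>A reduction operator is determined by its kernel\<close>

lemma RO_support_le:
  fixes T :: "('g \<Rightarrow> 'k::field) \<Rightarrow> ('g \<Rightarrow> 'k)"
  assumes "T \<in> RO G r d" "g \<in> G" "T (basis_vec g) h \<noteq> 0"
  shows "(h, g) \<in> r"
proof (cases "T (basis_vec g) = basis_vec g")
  case True
  then show ?thesis using assms r_refl by (auto simp: basis_vec_def split: if_splits)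
next
  case False
  then show ?thesis using assms by (auto simp: RO_def supp_def)
qed

text \<open>
  The difference \<open>g - T g\<close> of a moved term lies in the kernel and has leading term \<open>g\<close>.
  Conversely, if \<open>T\<close> fixes the leading term \<open>g\<close> of some \<open>v\<close>, then nothing in \<open>T v\<close> cancels its
  contribution at \<open>g\<close>, because the other terms of \<open>v\<close> are sent strictly below \<open>g\<close>.
\<close>

lemma RO_moves_iff_LM:
  fixes T :: "('g \<Rightarrow> 'k::field) \<Rightarrow> ('g \<Rightarrow> 'k)"
  assumes T: "T \<in> RO G r d" and g: "g \<in> G"
  shows "T (basis_vec g) \<noteq> basis_vec g \<longleftrightarrow> g \<in> LM r (ker G d T)"
proof
  have clp: "continuous_linear_projector G d T" using T by (simp add: RO_def)
  note b = basis_vec_hat[OF g, where ?'k = 'k]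
  show "g \<in> LM r (ker G d T)" if ne: "T (basis_vec g) \<noteq> basis_vec g"
  proof -
    let ?v = "basis_vec g - T (basis_vec g)"
    have Tb: "T (basis_vec g) \<in> KG_hat G d" by (rule projector_hat[OF clp b])
    have "T (basis_vec g) g = 0"
      using T g ne by (auto simp: RO_def supp_def)
    then have "leading r ?v g"
      using RO_support_le[OF T g] r_refl[OF g] by (auto simp: leading_def basis_vec_def)
    moreover have "?v \<in> ker G d T"
      using projector_diff[OF clp b Tb] projector_idem[OF clp b] KG_hat_diff[OF b Tb]
      by (simp add: ker_def)
    ultimately show ?thesis by (auto simp: LM_def)
  qed
  show "T (basis_vec g) \<noteq> basis_vec g" if lm: "g \<in> LM r (ker G d T)"
  proof
    assume fixed: "T (basis_vec g) = basis_vec g"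
    obtain v where v: "v \<in> KG_hat G d" "T v = 0" "leading r v g"
      using lm by (auto simp: LM_def ker_def)
    let ?c = "smul (v g) (basis_vec g)"
    have c: "?c \<in> KG_hat G d" by (rule KG_hat_smul[OF b])
    have "T (v - ?c) g = 0"
    proof (rule projector_coeff_zero[OF clp KG_hat_diff[OF v(1) c] g])
      fix h assume "(v - ?c) h \<noteq> 0"
      then have h: "h \<noteq> g" "v h \<noteq> 0" by (auto simp: basis_vec_def split: if_splits)
      then have "(h, g) \<in> r" using v(3) by (auto simp: leading_def)
      then show "T (basis_vec h) g = 0"
        using RO_support_le[OF T, of h g] r_antisym r_field h by blast
    qed
    then have "v g = 0"
      using projector_diff[OF clp v(1) c] projector_smul[OF clp b] fixed v(2)
      by (simp add: basis_vec_def)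
    then show False using v(3) by (simp add: leading_def)
  qed
qed

text \<open>
  At the greatest moved term of \<open>w = T u\<close>, the coefficient of \<open>T w\<close> vanishes: fixed terms do not
  contribute to it, and moved terms lie at or below it and are sent strictly below themselves.  As \<open>T w = w\<close>,
  no moved term occurs in \<open>w\<close>.
\<close>

lemma RO_is_normal_form:
  fixes T :: "('g \<Rightarrow> 'k::field) \<Rightarrow> ('g \<Rightarrow> 'k)"
  assumes T: "T \<in> RO G r d" and u: "u \<in> KG_hat G d"
  shows "normal_form (ker G d T) u (T u)"
proof -
  have clp: "continuous_linear_projector G d T" using T by (simp add: RO_def)
  have w: "T u \<in> KG_hat G d" by (rule projector_hat[OF clp u])
  have "u - T u \<in> ker G d T"
    using projector_diff[OF clp u w] projector_idem[OF clp u] KG_hat_diff[OF u w]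
    by (simp add: ker_def)
  moreover have "T u g = 0" if g: "g \<in> LM r (ker G d T)" for g
  proof (rule ccontr)
    assume "T u g \<noteq> 0"
    then obtain m where m: "m \<in> LM r (ker G d T)" "T u m \<noteq> 0"
      and max: "\<And>h. h \<in> LM r (ker G d T) \<Longrightarrow> T u h \<noteq> 0 \<Longrightarrow> (h, m) \<in> r"
      using support_has_greatest[OF w g] by blast
    have mG: "m \<in> G" using KG_hatD[OF w m(2)] .
    have "T (T u) m = 0"
    proof (rule projector_coeff_zero[OF clp w mG])
      fix h assume h: "T u h \<noteq> 0"
      have hG: "h \<in> G" using KG_hatD[OF w h] .
      show "T (basis_vec h) m = 0"
      proof (cases "h \<in> LM r (ker G d T)")
        case True
        then have "T (basis_vec h) \<noteq> basis_vec h" using RO_moves_iff_LM[OF T hG] by simp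
        then have "T (basis_vec h) m \<noteq> 0 \<Longrightarrow> (m, h) \<in> r - Id"
          using T hG by (auto simp: RO_def supp_def)
        then show ?thesis using max[OF True h] r_antisym by blast
      next
        case False
        then have "T (basis_vec h) = basis_vec h" using RO_moves_iff_LM[OF T hG] by simp
        then show ?thesis using False m(1) by (auto simp: basis_vec_def)
      qed
    qed
    then show False using projector_idem[OF clp u] m(2) by simp
  qed
  ultimately show ?thesis using w by (simp add: normal_form_def)
qed

lemma inj_on_ker: "inj_on (ker G d) (RO G r d :: (('g \<Rightarrow> 'k::field) \<Rightarrow> _) set)"
proof (rule inj_onI)
  fix T T' :: "('g \<Rightarrow> 'k) \<Rightarrow> ('g \<Rightarrow> 'k)"
  assume T: "T \<in> RO G r d" "T' \<in> RO G r d" and eq: "ker G d T = ker G d T'"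
  have clp: "continuous_linear_projector G d T" "continuous_linear_projector G d T'"
    using T by (auto simp: RO_def)
  have V: "ker G d T \<subseteq> KG_hat G d" "vec.subspace (ker G d T)"
    using ker_closed_subspace[OF clp(1)] by (auto simp: closed_subspaces_def)
  have "T u = T' u" if "u \<in> KG_hat G d" for u
    using normal_form_unique[OF V] RO_is_normal_form T that eq by metis
  moreover have "T \<in> KG_hat G d \<rightarrow>\<^sub>E KG_hat G d" "T' \<in> KG_hat G d \<rightarrow>\<^sub>E KG_hat G d"
    using clp by (auto simp: continuous_linear_projector_def)
  ultimately show "T = T'" by (metis PiE_ext)
qed

end

section \<open>Elimination along well-ordered levels\<close>

locale elimination_order = monotone_weight G d r for G :: "'g set" and d r +
  assumes level_wf: "\<And>n. n \<ge> 1 \<Longrightarrow> wf (Restr r (level G d n) - Id)"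
begin

context
  fixes V :: "('g \<Rightarrow> 'k::field) set"
  assumes V_closed: "V \<in> closed_subspaces G d"
begin

lemma V_hat: "V \<subseteq> KG_hat G d" and V_sub: "vec.subspace V"
  using V_closed by (auto simp: closed_subspaces_def)

text \<open>
  Induction on the greatest term \<open>m\<close> to be killed in the level; the vector of \<open>V\<close> used to kill it
  has leading term \<open>m\<close>, so all its terms have weight at most \<open>d m\<close>.
\<close>

lemma eliminate_level:
  assumes n: "n \<ge> 1" and u: "u \<in> KG_hat G d"
  shows "\<exists>v\<in>V. (\<forall>h. v h \<noteq> 0 \<longrightarrow> n = 1 \<or> d h < 1 / (real n - 1)) \<and>
           (\<forall>h \<in> LM r V \<inter> level G d n. u h = v h)"
proof -
  let ?B = "LM r V \<inter> level G d n"
  let ?P = "\<lambda>u v. (\<forall>h. v h \<noteq> 0 \<longrightarrow> n = 1 \<or> d h < 1 / (real n - 1)) \<and> (\<forall>h \<in> ?B. u h = v h)"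
  have main: "\<exists>v\<in>V. ?P u v"
    if "u \<in> KG_hat G d" "m \<in> ?B" "u m \<noteq> 0" "\<And>h. h \<in> ?B \<Longrightarrow> u h \<noteq> 0 \<Longrightarrow> (h, m) \<in> r" for m u
    using level_wf[OF n] that
  proof (induction m arbitrary: u rule: wf_induct_rule)
    case (less m)
    obtain x where x: "x \<in> V" "leading r x m" using less.prems(2) by (auto simp: LM_def)
    have xm: "x m \<noteq> 0" using x(2) by (simp add: leading_def)
    define y where "y = smul (u m / x m) x"
    have y: "y \<in> V" unfolding y_def by (rule vec.subspace_scale[OF V_sub x(1)])
    have ym: "y m = u m" using xm by (simp add: y_def)
    have y_le: "(h, m) \<in> r" if "y h \<noteq> 0" for h
      using that x(2) by (auto simp: y_def leading_def)
    have y_small: "n = 1 \<or> d h < 1 / (real n - 1)" if "y h \<noteq> 0" for h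
      using weight_le[OF y_le[OF that]] less.prems(2) by (auto simp: level_def)
    have uy: "u - y \<in> KG_hat G d" using KG_hat_diff[OF less.prems(1)] y V_hat by blast
    show ?case
    proof (cases "\<exists>h\<in>?B. (u - y) h \<noteq> 0")
      case False
      then have "?P u y" using y_small by auto
      then show ?thesis using y by blast
    next
      case True
      then obtain m' where m': "m' \<in> ?B" "(u - y) m' \<noteq> 0"
        and max': "\<And>h. h \<in> ?B \<Longrightarrow> (u - y) h \<noteq> 0 \<Longrightarrow> (h, m') \<in> r"
        using support_has_greatest[OF uy, of _ ?B] by blast
      have "m' \<noteq> m" using m'(2) ym by auto
      moreover have "u m' \<noteq> 0 \<or> y m' \<noteq> 0" using m'(2) by auto
      then have "(m', m) \<in> r" using less.prems(4)[OF m'(1)] y_le by blast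
      ultimately have "(m', m) \<in> Restr r (level G d n) - Id"
        using m'(1) less.prems(2) by auto
      then obtain v where v: "v \<in> V" "?P (u - y) v"
        using less.IH[OF _ uy m' max'] by blast
      have "?P u (y + v)"
      proof (intro conjI allI impI ballI)
        fix h assume "(y + v) h \<noteq> 0"
        then have "y h \<noteq> 0 \<or> v h \<noteq> 0" by auto
        then show "n = 1 \<or> d h < 1 / (real n - 1)" using y_small v(2) by blast
      next
        fix h assume "h \<in> ?B"
        then have "(u - y) h = v h" using v(2) by blast
        then show "u h = (y + v) h" by (simp add: algebra_simps)
      qed
      then show ?thesis using vec.subspace_add[OF V_sub y v(1)] by blast
    qed
  qed
  show ?thesis
  proof (cases "\<exists>h\<in>?B. u h \<noteq> 0")
    case True
    then obtain m where "m \<in> ?B" "u m \<noteq> 0" "\<And>h. h \<in> ?B \<Longrightarrow> u h \<noteq> 0 \<Longrightarrow> (h, m) \<in> r"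
      using support_has_greatest[OF u, of _ ?B] by blast
    then show ?thesis by (rule main[OF u])
  next
    case False
    then have "?P u 0" by simp
    then show ?thesis using vec.subspace_0[OF V_sub] by blast
  qed
qed

lemma normal_form_exists:
  assumes u: "u \<in> KG_hat G d"
  shows "\<exists>w. normal_form V u w"
proof -
  \<comment> \<open>\<open>x n\<close> is what remains of \<open>u\<close> once the levels \<open>1, \<dots>, n\<close> have been treated.  The guards
    \<open>n \<ge> 1\<close> exclude the convention \<open>1 / 0 = 0\<close>, where infinity would be meant.\<close>
  let ?P = "\<lambda>n x. x \<in> KG_hat G d \<and> u - x \<in> V \<and>
    (\<forall>h\<in>LM r V. n \<ge> 1 \<longrightarrow> 1 / real n \<le> d h \<longrightarrow> x h = 0)"
  let ?Q = "\<lambda>n x y. \<forall>h. n \<ge> 1 \<longrightarrow> 1 / real n \<le> d h \<longrightarrow> y h = x h"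
  have LM_G: "LM r V \<subseteq> G"
  proof
    fix g assume "g \<in> LM r V"
    then obtain v where "v \<in> V" "v g \<noteq> 0" by (auto simp: LM_def leading_def)
    then show "g \<in> G" using KG_hatD[of v G d g] V_hat by auto
  qed
  have "\<exists>x. \<forall>n. ?P n (x n) \<and> ?Q n (x n) (x (Suc n))"
  proof (rule dependent_nat_choice)
    show "\<exists>x. ?P 0 x"
      using u vec.subspace_0[OF V_sub] by (intro exI[of _ u]) simp
  next
    fix x :: "'g \<Rightarrow> 'k" and n :: nat
    assume x: "?P n x"
    obtain v where v: "v \<in> V" "\<And>h. v h \<noteq> 0 \<Longrightarrow> n = 0 \<or> d h < 1 / real n"
      "\<And>h. h \<in> LM r V \<inter> level G d (Suc n) \<Longrightarrow> x h = v h"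
      using eliminate_level[of "Suc n" x] x by auto
    have Q: "?Q n x (x - v)"
    proof (intro allI impI)
      fix h assume "1 \<le> n" "1 / real n \<le> d h"
      then have "v h = 0" using v(2)[of h] by fastforce
      then show "(x - v) h = x h" by simp
    qed
    have "(x - v) h = 0" if h: "h \<in> LM r V" "1 / real (Suc n) \<le> d h" for h
    proof (cases "h \<in> level G d (Suc n)")
      case True
      then show ?thesis using v(3) h by simp
    next
      case False
      then have "n \<ge> 1" "1 / real n \<le> d h" using h LM_G by (auto simp: level_def)
      then show ?thesis using Q x h(1) by auto
    qed
    moreover have "x - v \<in> KG_hat G d" using KG_hat_diff x v(1) V_hat by blast
    moreover have "u - (x - v) \<in> V"
      using vec.subspace_add[OF V_sub, of "u - x" v] x v(1) by (simp add: algebra_simps)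
    ultimately show "\<exists>y. ?P (Suc n) y \<and> ?Q n x y" using Q by blast
  qed
  then obtain x where P: "\<And>n. ?P n (x n)" and Q: "\<And>n. ?Q n (x n) (x (Suc n))" by blast
  have stable: "x n h = x m h" if "m \<le> n" "m \<ge> 1" "1 / real m \<le> d h" for m n h
    using that(1)
  proof (induction n rule: dec_induct)
    case (step n)
    have "1 / real n \<le> 1 / real m" using step.hyps that(2) by (intro divide_left_mono) auto
    then have "1 \<le> n" "1 / real n \<le> d h" using step.hyps that(2,3) by linarith+
    then show ?case using Q step.IH by simp
  qed simp
  \<comment> \<open>From stage \<open>N \<epsilon>\<close> on, coefficients in weight \<open>\<ge> \<epsilon>\<close> no longer change; \<open>w\<close> is the limit.\<close>
  define N where "N \<epsilon> = Suc (nat \<lceil>1 / \<epsilon>\<rceil>)" for \<epsilon> :: real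
  have N: "1 \<le> N \<epsilon>" "1 / real (N \<epsilon>) \<le> \<epsilon>" if "\<epsilon> > 0" for \<epsilon>
  proof -
    have "1 / \<epsilon> \<le> real (N \<epsilon>)" unfolding N_def by linarith
    moreover have "real (N \<epsilon>) > 0" by (simp add: N_def)
    ultimately show "1 / real (N \<epsilon>) \<le> \<epsilon>" using that by (simp add: field_simps)
  qed (simp add: N_def)
  define w where "w h = x (N (d h)) h" for h
  have w_eq: "w h = x (N \<epsilon>) h" if "\<epsilon> > 0" "\<epsilon> \<le> d h" for \<epsilon> h
  proof -
    let ?M = "max (N \<epsilon>) (N (d h))"
    have "x ?M h = x (N \<epsilon>) h" using N[OF that(1)] that by (intro stable) auto
    moreover have "x ?M h = x (N (d h)) h" using N[of "d h"] that by (intro stable) auto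
    ultimately show ?thesis by (simp add: w_def)
  qed
  have w: "w \<in> KG_hat G d"
    unfolding KG_hat_def
  proof (intro CollectI conjI allI impI)
    have "g \<in> G" if "w g \<noteq> 0" for g
      using KG_hatD[of "x (N (d g))" G d g] P that by (simp add: w_def)
    then show "supp w \<subseteq> G" by (auto simp: supp_def)
    fix \<epsilon> :: real assume e: "\<epsilon> > 0"
    have "{g \<in> supp w. \<epsilon> \<le> d g} = {g \<in> supp (x (N \<epsilon>)). \<epsilon> \<le> d g}"
      using w_eq[OF e] by (auto simp: supp_def)
    then show "finite {g \<in> supp w. \<epsilon> \<le> d g}" using P e by (simp add: KG_hat_def)
  qed
  have "u - w \<in> V"
  proof (rule closed_subspace_limit[OF V_closed KG_hat_diff[OF u w]])
    fix \<epsilon> :: real assume "\<epsilon> > 0"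
    then have "\<forall>g. \<epsilon> \<le> d g \<longrightarrow> (u - w) g = (u - x (N \<epsilon>)) g" using w_eq by simp
    then show "\<exists>v\<in>V. \<forall>g. \<epsilon> \<le> d g \<longrightarrow> (u - w) g = v g" using P by blast
  qed
  moreover have "w h = 0" if "h \<in> LM r V" for h
    using P[of "N (d h)"] N[of "d h"] weight_pos LM_G that by (auto simp: w_def)
  ultimately show ?thesis using w by (auto simp: normal_form_def)
qed

text \<open>The restriction makes the map extensional, as elements of \<open>RO G r d\<close> have to be.\<close>

definition nf_operator :: "('g \<Rightarrow> 'k) \<Rightarrow> ('g \<Rightarrow> 'k)" where
  "nf_operator = (\<lambda>u\<in>KG_hat G d. THE w. normal_form V u w)"

lemma nf_operator_normal_form:
  assumes "u \<in> KG_hat G d"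
  shows "normal_form V u (nf_operator u)"
proof -
  have "\<exists>!w. normal_form V u w"
    using normal_form_exists[OF assms] normal_form_unique[OF V_hat V_sub] by blast
  then show ?thesis using assms by (simp add: nf_operator_def theI')
qed

lemma nf_operator_eqI: "u \<in> KG_hat G d \<Longrightarrow> normal_form V u w \<Longrightarrow> nf_operator u = w"
  using nf_operator_normal_form normal_form_unique[OF V_hat V_sub] by blast

lemma nf_operator_RO: "nf_operator \<in> RO G r d"
proof -
  let ?T = nf_operator
  note nf = nf_operator_normal_form
  have hat: "?T u \<in> KG_hat G d" if "u \<in> KG_hat G d" for u
    using nf[OF that] by (simp add: normal_form_def)
  have add: "?T (u + v) = ?T u + ?T v" if "u \<in> KG_hat G d" "v \<in> KG_hat G d" for u v
    using that by (intro nf_operator_eqI normal_form_add[OF V_hat V_sub] nf KG_hat_add)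
  have smul: "?T (smul c u) = smul c (?T u)" if "u \<in> KG_hat G d" for c u
    using that by (intro nf_operator_eqI normal_form_smul[OF V_hat V_sub] nf KG_hat_smul)
  have diff: "?T (u - v) = ?T u - ?T v" if "u \<in> KG_hat G d" "v \<in> KG_hat G d" for u v
    using add[OF KG_hat_diff[OF that] that(2)] by (simp add: algebra_simps)
  have fixed: "?T w = w" if "w \<in> KG_hat G d" "\<And>g. g \<in> LM r V \<Longrightarrow> w g = 0" for w
    by (rule nf_operator_eqI)
      (use that vec.subspace_0[OF V_sub] in \<open>auto simp: normal_form_def\<close>)
  have idem: "?T (?T u) = ?T u" if "u \<in> KG_hat G d" for u
    using nf[OF that] by (intro fixed) (auto simp: normal_form_def)
  have cont: "continuous_map (hat_topology G d) (hat_topology G d) ?T"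
  proof (rule continuous_if_weight_nonincreasing[OF hat diff])
    fix u :: "'g \<Rightarrow> 'k" and \<epsilon> :: real
    assume u: "u \<in> KG_hat G d" and zero: "\<forall>g. \<epsilon> \<le> d g \<longrightarrow> u g = 0"
    show "\<forall>g. \<epsilon> \<le> d g \<longrightarrow> ?T u g = 0"
    proof (intro allI impI, rule ccontr)
      fix h assume h: "\<epsilon> \<le> d h" "?T u h \<noteq> 0"
      obtain g where "u g \<noteq> 0" "(h, g) \<in> r"
        using normal_form_bounded[OF V_hat V_sub nf[OF u] h(2)] by blast
      then show False using weight_le[of h g] h(1) zero by fastforce
    qed
  qed
  have "continuous_linear_projector G d ?T"
    unfolding continuous_linear_projector_def
    using hat add smul cont idem by (auto simp: nf_operator_def)
  moreover have "(h, g) \<in> r - Id"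
    if g: "g \<in> G" and ne: "?T (basis_vec g) \<noteq> basis_vec g" and h: "?T (basis_vec g) h \<noteq> 0" for g h
  proof -
    note b = basis_vec_hat[OF g, where ?'k = 'k]
    \<comment> \<open>A basis vector outside the leading terms is its own normal form.\<close>
    have "g \<in> LM r V"
    proof (rule ccontr)
      assume "g \<notin> LM r V"
      then have "?T (basis_vec g) = basis_vec g" by (intro fixed[OF b]) (auto simp: basis_vec_def)
      then show False using ne by contradiction
    qed
    then have "h \<noteq> g" using nf[OF b] h by (auto simp: normal_form_def)
    moreover have "(h, g) \<in> r"
      using normal_form_bounded[OF V_hat V_sub nf[OF b] h]
      by (auto simp: basis_vec_def split: if_splits)
    ultimately show ?thesis by simp
  qed
  ultimately show ?thesis by (auto simp: RO_def supp_def)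
qed

lemma ker_nf_operator: "ker G d nf_operator = V"
proof
  show "ker G d nf_operator \<subseteq> V"
    using nf_operator_normal_form by (fastforce simp: ker_def normal_form_def)
  show "V \<subseteq> ker G d nf_operator"
  proof
    fix v assume v: "v \<in> V"
    then have hat: "v \<in> KG_hat G d" using V_hat by blast
    have "nf_operator v = 0"
      using v hat by (intro nf_operator_eqI) (auto simp: normal_form_def KG_hat_zero)
    then show "v \<in> ker G d nf_operator" using hat by (simp add: ker_def)
  qed
qed

end

lemma bij_betw_ker:
  "bij_betw (ker G d) (RO G r d) (closed_subspaces G d :: ('g \<Rightarrow> 'k::field) set set)"
  unfolding bij_betw_def
proof (intro conjI equalityI subsetI)
  show "inj_on (ker G d) (RO G r d :: (('g \<Rightarrow> 'k) \<Rightarrow> _) set)" by (rule inj_on_ker)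
next
  fix V :: "('g \<Rightarrow> 'k) set"
  assume "V \<in> ker G d ` RO G r d"
  then show "V \<in> closed_subspaces G d" using ker_closed_subspace by (auto simp: RO_def)
next
  fix V :: "('g \<Rightarrow> 'k) set"
  assume V: "V \<in> closed_subspaces G d"
  then show "V \<in> ker G d ` RO G r d"
    using nf_operator_RO[OF V] ker_nf_operator[OF V] by (metis imageI)
qed

section \<open>The lattice of reduction operators\<close>

lemma ker_ker_inv:
  fixes V :: "('g \<Rightarrow> 'k::field) set"
  assumes "V \<in> closed_subspaces G d"
  shows "ker_inv G r d V \<in> RO G r d" "ker G d (ker_inv G r d V) = V"
proof -
  have "V \<in> ker G d ` RO G r d" using bij_betw_ker[where ?'k = 'k] assms by (simp add: bij_betw_def)
  then show "ker_inv G r d V \<in> RO G r d" "ker G d (ker_inv G r d V) = V"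
    unfolding ker_inv_def by (rule inv_into_into, rule f_inv_into_f)
qed

lemma partial_order_RO:
  "partial_order (RO_order G r d :: (('g \<Rightarrow> 'k::field) \<Rightarrow> ('g \<Rightarrow> 'k)) gorder)"
  by standard (auto simp: RO_order_def dest: inj_onD[OF inj_on_ker, rotated])

lemma least_RO_join:
  fixes T1 T2 :: "('g \<Rightarrow> 'k::field) \<Rightarrow> ('g \<Rightarrow> 'k)"
  assumes T: "T1 \<in> RO G r d" "T2 \<in> RO G r d"
  shows "least (RO_order G r d) (ker_inv G r d (ker G d T1 \<inter> ker G d T2))
           (Upper (RO_order G r d) {T1, T2})"
proof -
  have cl: "ker G d T1 \<in> closed_subspaces G d" "ker G d T2 \<in> closed_subspaces G d"
    using T ker_closed_subspace by (auto simp: RO_def)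
  note inv = ker_ker_inv[OF Int_closed_subspace[OF cl]]
  show ?thesis using T inv by (auto simp: least_def Upper_def RO_order_def)
qed

lemma greatest_RO_meet:
  fixes T1 T2 :: "('g \<Rightarrow> 'k::field) \<Rightarrow> ('g \<Rightarrow> 'k)"
  assumes T: "T1 \<in> RO G r d" "T2 \<in> RO G r d"
  shows "greatest (RO_order G r d) (ker_inv G r d (closure_sum G d (ker G d T1) (ker G d T2)))
           (Lower (RO_order G r d) {T1, T2})"
proof -
  have cl: "ker G d T \<in> closed_subspaces G d" if "T \<in> RO G r d" for T :: "('g \<Rightarrow> 'k) \<Rightarrow> _"
    using that ker_closed_subspace by (auto simp: RO_def)
  note closed = closure_sum_closed_subspace[OF cl[OF T(1)] cl[OF T(2)]]
  note inv = ker_ker_inv[OF closed]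
  note iff = closure_sum_subset_iff[OF _ cl[OF T(1)] cl[OF T(2)]]
  have "ker G d T1 \<subseteq> closure_sum G d (ker G d T1) (ker G d T2)"
    "ker G d T2 \<subseteq> closure_sum G d (ker G d T1) (ker G d T2)"
    using iff[OF closed] by auto
  then show ?thesis
    using T inv iff[OF cl] by (auto simp: greatest_def Lower_def RO_order_def)
qed

lemma lattice_RO:
  "Lattice.lattice (RO_order G r d :: (('g \<Rightarrow> 'k::field) \<Rightarrow> ('g \<Rightarrow> 'k)) gorder)"
proof -
  interpret partial_order "RO_order G r d :: (('g \<Rightarrow> 'k) \<Rightarrow> ('g \<Rightarrow> 'k)) gorder"
    by (rule partial_order_RO)
  show ?thesis
    by standard (use least_RO_join greatest_RO_meet in \<open>fastforce simp: RO_order_def\<close>)+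
qed

lemma join_RO:
  fixes T1 T2 :: "('g \<Rightarrow> 'k::field) \<Rightarrow> ('g \<Rightarrow> 'k)"
  assumes "T1 \<in> RO G r d" "T2 \<in> RO G r d"
  shows "T1 \<squnion>\<^bsub>RO_order G r d\<^esub> T2 = ker_inv G r d (ker G d T1 \<inter> ker G d T2)"
proof -
  interpret partial_order "RO_order G r d :: (('g \<Rightarrow> 'k) \<Rightarrow> ('g \<Rightarrow> 'k)) gorder"
    by (rule partial_order_RO)
  show ?thesis
    unfolding join_def sup_def
    using least_RO_join[OF assms] least_unique by (intro some_equality) blast+
qed

lemma meet_RO:
  fixes T1 T2 :: "('g \<Rightarrow> 'k::field) \<Rightarrow> ('g \<Rightarrow> 'k)"
  assumes "T1 \<in> RO G r d" "T2 \<in> RO G r d"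
  shows "T1 \<sqinter>\<^bsub>RO_order G r d\<^esub> T2 = ker_inv G r d (closure_sum G d (ker G d T1) (ker G d T2))"
proof -
  interpret partial_order "RO_order G r d :: (('g \<Rightarrow> 'k) \<Rightarrow> ('g \<Rightarrow> 'k)) gorder"
    by (rule partial_order_RO)
  show ?thesis
    unfolding meet_def inf_def
    using greatest_RO_meet[OF assms] greatest_unique by (intro some_equality) blast+
qed

end

theorem theorem2p2p4:
  fixes G :: "'g set" and r :: "'g rel" and d :: "'g \<Rightarrow> real"
  assumes "linear_order_on G r"
    and "\<And>g. g \<in> G \<Longrightarrow> d g > 0"
    and "elimination_map G r d"
  shows "bij_betw (ker G d) (RO G r d) (closed_subspaces G d :: ('g \<Rightarrow> 'k::field) set set) \<and>
    Lattice.lattice (RO_order G r d :: (('g \<Rightarrow> 'k) \<Rightarrow> ('g \<Rightarrow> 'k)) gorder) \<and>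
    (\<forall>T1 \<in> RO G r d. \<forall>T2 \<in> RO G r d.
       closure_sum G d (ker G d T1) (ker G d T2 :: ('g \<Rightarrow> 'k) set) \<in> closed_subspaces G d \<and>
       T1 \<sqinter>\<^bsub>RO_order G r d\<^esub> T2 = ker_inv G r d (closure_sum G d (ker G d T1) (ker G d T2)) \<and>
       ker G d T1 \<inter> ker G d T2 \<in> closed_subspaces G d \<and>
       T1 \<squnion>\<^bsub>RO_order G r d\<^esub> T2 = ker_inv G r d (ker G d T1 \<inter> ker G d T2))"
proof -
  interpret elimination_order G d r
    by unfold_locales
      (use assms in \<open>auto simp: elimination_map_def well_order_on_def\<close>)
  have "ker G d T \<in> closed_subspaces G d" if "T \<in> RO G r d" for T :: "('g \<Rightarrow> 'k) \<Rightarrow> _"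
    using that ker_closed_subspace by (auto simp: RO_def)
  then show ?thesis
    by (intro conjI ballI bij_betw_ker lattice_RO join_RO meet_RO
        closure_sum_closed_subspace Int_closed_subspace)
qed

end
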